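(* Let $\mathbf{A}\in\mathbb{C}^{n\times m}$ and let $k\ge 1$ be an integer. Let $\hat{\mathbf{A}}^{(k)}$ be the (random) approximation of $\mathbf{A}$ produced by $k$ steps of randomly pivoted LU, so that $\mathbf{A}-\hat{\mathbf{A}}^{(k)}=\mathbf{A}^{(k)}$ is the $k$th Schur complement (residual). Then $$\mathbb{E}\,\bigl\|\mathbf{A}-\hat{\mathbf{A}}^{(k)}\bigr\|_F^{2}\;\le\;4^{k}\,\bigl\|\mathbf{A}-\llbracket\mathbf{A}\rrbracket_{k}\bigr\|_F^{2},$$ where the expectation is over the random choice of pivots and $\llbracket\mathbf{A}\rrbracket_{k}$ is the rank-$k$ truncated SVD of $\mathbf{A}$.
   Context: Notation: $\|\cdot\|_F$ is the Frobenius norm; for a matrix $\mathbf{M}$, $\mathbf{M}_{i,:}$ is its $i$-th row, $\mathbf{M}_{:,j}$ its $j$-th column, and $\mathbf{M}_{i,j}$ its $(i,j)$ entry. Truncated SVD: if $\mathbf{A}=\mathbf{U}\boldsymbol{\Sigma}\mathbf{V}^*$ is a singular value decomposition with singular values $\sigma_1\ge\sigma_2\ge\cdots\ge 0$, then $\llbracket\mathbf{A}\rrbracket_k=\mathbf{U}_{:,1:k}\boldsymbol{\Sigma}_{1:k,1:k}\mathbf{V}_{:,1:k}^*$ (and $\llbracket\mathbf{A}\rrbracket_k=\mathbf{A}$ if $k\ge\min(n,m)$). Thus $\|\mathbf{A}-\llbracket\mathbf{A}\rrbracket_k\|_F^2=\sum_{j>k}\sigma_j^2$. Randomly pivoted LU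 (RPLU): set $\mathbf{A}^{(0)}=\mathbf{A}$ and $\hat{\mathbf{A}}^{(0)}=\mathbf{0}$. At step $t\ge 1$, given $\mathbf{A}^{(t-1)}\neq\mathbf{0}$, draw a pivot $(i_t,j_t)\in\{1,\dots,n\}\times\{1,\dots,m\}$ with conditional probability $$\mathbb{P}\bigl((i_t,j_t)=(i,j)\mid\mathbf{A}^{(t-1)}\bigr)=\frac{|\mathbf{A}^{(t-1)}_{i,j}|^2}{\|\mathbf{A}^{(t-1)}\|_F^2},$$ and update $$\mathbf{A}^{(t)}=\mathbf{A}^{(t-1)}-\frac{1}{\mathbf{A}^{(t-1)}_{i_t,j_t}}\mathbf{A}^{(t-1)}_{:,j_t}\mathbf{A}^{(t-1)}_{i_t,:},\qquad \hat{\mathbf{A}}^{(t)}=\hat{\mathbf{A}}^{(t-1)}+\frac{1}{\mathbf{A}^{(t-1)}_{i_t,j_t}}\mathbf{A}^{(t-1)}_{:,j_t}\mathbf{A}^{(t-1)}_{i_t,:}.$$ Convention: if $\mathbf{A}^{(t-1)}=\mathbf{0}$, then $\mathbf{A}^{(t)}=\mathbf{0}$ and $\hat{\mathbf{A}}^{(t)}=\hat{\mathbf{A}}^{(t-1)}$. *)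

theory Defs
  imports
    "HOL-Probability.Probability_Mass_Function"
    "Jordan_Normal_Form.Schur_Decomposition"
begin

definition frobenius_norm :: "complex mat \<Rightarrow> real" where
  "frobenius_norm A = sqrt (\<Sum>i<dim_row A. \<Sum>j<dim_col A. (cmod (A $$ (i, j)))\<^sup>2)"

definition unitary_mat :: "complex mat \<Rightarrow> bool" where
  "unitary_mat U \<longleftrightarrow> square_mat U \<and> mat_adjoint U * U = 1\<^sub>m (dim_row U) \<and> U * mat_adjoint U = 1\<^sub>m (dim_row U)"

(* Full SVD: U is n x n, S is n x m, V is m x m. The sequence sg is indexed from 0; only its first
   min n m entries matter, so extending it to all naturals (by 0, say) is no restriction. *)
definition is_svd :: "complex mat \<Rightarrow> complex mat \<Rightarrow> complex mat \<Rightarrow> complex mat \<Rightarrow> bool" where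
  "is_svd A U S V \<longleftrightarrow>
     U \<in> carrier_mat (dim_row A) (dim_row A) \<and> unitary_mat U \<and>
     V \<in> carrier_mat (dim_col A) (dim_col A) \<and> unitary_mat V \<and>
     (\<exists>sg :: nat \<Rightarrow> real. antimono sg \<and> (\<forall>i. 0 \<le> sg i) \<and>
        S = mat (dim_row A) (dim_col A) (\<lambda>(i, j). if i = j then complex_of_real (sg i) else 0)) \<and>
     A = U * S * mat_adjoint V"

definition leading_block :: "nat \<Rightarrow> nat \<Rightarrow> complex mat \<Rightarrow> complex mat" where
  "leading_block r c M = mat r c (\<lambda>(i, j). M $$ (i, j))"

(* An SVD, and hence its truncation, is in general not unique (repeated singular values), so this is
   a relation: B is the rank-k truncation of some SVD of A. *)
definition is_truncated_svd :: "nat \<Rightarrow> complex mat \<Rightarrow> complex mat \<Rightarrow> bool" where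
  "is_truncated_svd k A B \<longleftrightarrow>
     (\<exists>U S V. is_svd A U S V \<and>
        B = (if k \<ge> min (dim_row A) (dim_col A) then A
             else leading_block (dim_row A) k U * leading_block k k S *
                  mat_adjoint (leading_block (dim_col A) k V)))"

(* Only meaningful for a nonzero matrix R, see pmf_pivot_pmf. Indices start at 0. *)
definition pivot_pmf :: "complex mat \<Rightarrow> (nat \<times> nat) pmf" where
  "pivot_pmf R = embed_pmf (\<lambda>(i, j). if i < dim_row R \<and> j < dim_col R
     then (cmod (R $$ (i, j)))\<^sup>2 / (frobenius_norm R)\<^sup>2 else 0)"

(* (1 / R_ij) R_{:,j} R_{i,:} *)
definition cross_term :: "complex mat \<Rightarrow> nat \<Rightarrow> nat \<Rightarrow> complex mat" where
  "cross_term R i j =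
     mat (dim_row R) (dim_col R) (\<lambda>(p, q). 1 / R $$ (i, j) * (R $$ (p, j) * R $$ (i, q)))"

(* The state is the pair (residual, approximation). *)
definition rplu_step :: "complex mat \<times> complex mat \<Rightarrow> (complex mat \<times> complex mat) pmf" where
  "rplu_step = (\<lambda>(R, H).
     if R = 0\<^sub>m (dim_row R) (dim_col R) then return_pmf (R, H)
     else map_pmf (\<lambda>(i, j). (R - cross_term R i j, H + cross_term R i j)) (pivot_pmf R))"

fun rplu :: "complex mat \<Rightarrow> nat \<Rightarrow> (complex mat \<times> complex mat) pmf" where
  "rplu A 0 = return_pmf (A, 0\<^sub>m (dim_row A) (dim_col A))"
| "rplu A (Suc t) = bind_pmf (rplu A t) rplu_step"

definition rplu_approx :: "complex mat \<Rightarrow> nat \<Rightarrow> complex mat pmf" where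
  "rplu_approx A k = map_pmf snd (rplu A k)"

lemma frobenius_norm_sq:
  "(frobenius_norm A)\<^sup>2 = (\<Sum>i<dim_row A. \<Sum>j<dim_col A. (cmod (A $$ (i, j)))\<^sup>2)"
  unfolding frobenius_norm_def by (simp add: sum_nonneg)

lemma frobenius_norm_eq_0_iff:
  "frobenius_norm A = 0 \<longleftrightarrow> A = 0\<^sub>m (dim_row A) (dim_col A)"
proof -
  have "frobenius_norm A = 0 \<longleftrightarrow> (\<forall>i<dim_row A. \<forall>j<dim_col A. A $$ (i, j) = 0)"
    unfolding frobenius_norm_def
    by (auto simp: sum_nonneg_eq_0_iff sum_nonneg)
  also have "\<dots> \<longleftrightarrow> A = 0\<^sub>m (dim_row A) (dim_col A)"
    by (auto simp: mat_eq_iff)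
  finally show ?thesis .
qed

lemma pmf_pivot_pmf:
  assumes "R \<noteq> 0\<^sub>m (dim_row R) (dim_col R)"
  shows "pmf (pivot_pmf R) (i, j) = (if i < dim_row R \<and> j < dim_col R
    then (cmod (R $$ (i, j)))\<^sup>2 / (frobenius_norm R)\<^sup>2 else 0)"
proof -
  let ?f = "\<lambda>(i, j). if i < dim_row R \<and> j < dim_col R
     then (cmod (R $$ (i, j)))\<^sup>2 / (frobenius_norm R)\<^sup>2 else 0"
  let ?D = "{..<dim_row R} \<times> {..<dim_col R}"
  have nz: "(frobenius_norm R)\<^sup>2 \<noteq> 0"
    using assms frobenius_norm_eq_0_iff[of R] by simp
  have "(\<integral>\<^sup>+x. ennreal (?f x) \<partial>count_space UNIV) = (\<Sum>x\<in>?D. ennreal (?f x))"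
    by (rule nn_integral_count_space'[of ?D]) (auto split: prod.splits)
  also have "\<dots> = ennreal (\<Sum>x\<in>?D. ?f x)"
    by (rule sum_ennreal) auto
  also have "(\<Sum>x\<in>?D. ?f x) =
      (\<Sum>i<dim_row R. \<Sum>j<dim_col R. (cmod (R $$ (i, j)))\<^sup>2 / (frobenius_norm R)\<^sup>2)"
    by (subst sum.cartesian_product) (rule sum.cong, auto)
  also have "\<dots> = (frobenius_norm R)\<^sup>2 / (frobenius_norm R)\<^sup>2"
    by (simp add: frobenius_norm_sq flip: sum_divide_distrib)
  also have "\<dots> = 1"
    using nz by simp
  finally have "(\<integral>\<^sup>+x. ennreal (?f x) \<partial>count_space UNIV) = 1"
    by simp
  then have "pmf (embed_pmf ?f) (i, j) = ?f (i, j)"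
    by (intro pmf_embed_pmf) auto
  then show ?thesis
    unfolding pivot_pmf_def by simp
qed

lemma set_pmf_pivot_pmf:
  assumes "R \<noteq> 0\<^sub>m (dim_row R) (dim_col R)"
  shows "set_pmf (pivot_pmf R) = {(i, j). i < dim_row R \<and> j < dim_col R \<and> R $$ (i, j) \<noteq> 0}"
proof -
  have "frobenius_norm R \<noteq> 0"
    using assms frobenius_norm_eq_0_iff by blast
  then show ?thesis
    by (auto simp: set_pmf_eq pmf_pivot_pmf[OF assms] split: if_splits)
qed

(* Hence expectations over rplu are finite sums; integrability is never an issue. *)
lemma finite_set_pmf_rplu: "finite (set_pmf (rplu A k))"
proof (induction k)
  case (Suc k)
  have "finite (set_pmf (rplu_step x))" for x
  proof -
    obtain R H where x: "x = (R, H)" by (cases x)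
    have "finite {(i, j). i < dim_row R \<and> j < dim_col R \<and> R $$ (i, j) \<noteq> 0}"
      by (rule finite_subset[of _ "{..<dim_row R} \<times> {..<dim_col R}"]) auto
    then show ?thesis
      by (simp add: x rplu_step_def set_pmf_pivot_pmf)
  qed
  with Suc show ?case by (simp add: set_bind_pmf)
qed simp

lemma rplu_residual:
  assumes "A \<in> carrier_mat n m" "(R, H) \<in> set_pmf (rplu A k)"
  shows "R \<in> carrier_mat n m \<and> H \<in> carrier_mat n m \<and> A - H = R"
  using assms(2)
proof (induction k arbitrary: R H)
  case 0
  then show ?case using assms(1) by auto
next
  case (Suc k)
  then obtain R' H' where RH': "(R', H') \<in> set_pmf (rplu A k)"
    and step: "(R, H) \<in> set_pmf (rplu_step (R', H'))"
    by (auto simp: set_bind_pmf)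
  from Suc.IH[OF RH'] have IH: "R' \<in> carrier_mat n m" "H' \<in> carrier_mat n m" "A - H' = R'"
    by auto
  show ?case
  proof (cases "R' = 0\<^sub>m (dim_row R') (dim_col R')")
    case True
    with step IH show ?thesis by (auto simp: rplu_step_def)
  next
    case False
    with step obtain i j where ij: "R = R' - cross_term R' i j" "H = H' + cross_term R' i j"
      by (auto simp: rplu_step_def)
    have "cross_term R' i j \<in> carrier_mat n m"
      using IH by (auto simp: cross_term_def)
    with IH assms(1) ij show ?thesis by (auto simp: mat_eq_iff)
  qed
qed

end

theory Submission
  imports Defs
begin

text \<open>
  The bound holds for an arbitrary matrix of rank at most \<open>k\<close> in place of the truncated SVD, by
  induction on \<open>k\<close>: if \<open>A\<close> has an approximation of rank \<open>k + 1\<close> with squared error \<open>\<epsilon>\<close>, then the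
  Schur complements after one pivot have approximations of rank \<open>k\<close> whose squared errors average to
  at most \<open>4 \<epsilon>\<close>. The pivot is drawn as a column \<open>j\<close> with probability proportional to
  \<open>|a\<^sub>j|\<^sup>2\<close>, then a row \<open>i\<close> with probability proportional to \<open>|A\<^sub>i\<^sub>j|\<^sup>2\<close>;
  each of the two draws costs a factor 2.

  Column draw: let \<open>N\<close> be the orthogonal projection of \<open>A\<close> onto the column space of the
  approximation and \<open>E = A - N\<close>. After projecting away \<open>a\<^sub>j = n\<^sub>j + e\<^sub>j\<close>, approximate
  by the part of \<open>N\<close> orthogonal to \<open>n\<^sub>j\<close>, which has rank \<open>k\<close>. The cross terms of the error sum
  over \<open>j\<close> to \<open>- 2 |E N\<^sup>*|\<^sup>2 \<le> 0\<close>, so no optimality of the approximation is needed.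

  Row draw: elimination with row \<open>i\<close> differs from the orthogonal projection only by a multiple of
  \<open>a\<^sub>j\<close>, and the weight \<open>|A\<^sub>i\<^sub>j|\<^sup>2\<close> cancels the division by the pivot.
\<close>

section \<open>Inner products and squared norms of vectors, orthogonal projection\<close>

text \<open>Vectors are functions on the naturals of which only the first \<open>n\<close> values
  count, so columns and their combinations are plain lambda terms without dimension side conditions.
  The product is conjugate-linear in the first argument.\<close>

definition cdot :: "nat \<Rightarrow> (nat \<Rightarrow> complex) \<Rightarrow> (nat \<Rightarrow> complex) \<Rightarrow> complex" where
  "cdot n u v = (\<Sum>p<n. cnj (u p) * v p)"

definition nsq :: "nat \<Rightarrow> (nat \<Rightarrow> complex) \<Rightarrow> real" where
  "nsq n v = (\<Sum>p<n. (cmod (v p))\<^sup>2)"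

lemma nsq_nonneg [simp]: "0 \<le> nsq n v"
  unfolding nsq_def by (simp add: sum_nonneg)

lemma of_real_nsq: "complex_of_real (nsq n v) = cdot n v v"
  by (simp add: nsq_def cdot_def complex_norm_square mult.commute del: of_real_power)

lemma cdot_cnj: "cnj (cdot n u v) = cdot n v u"
  by (simp add: cdot_def mult.commute)

lemma cdot_simps [simp]:
  "cdot n u (\<lambda>p. v p + w p) = cdot n u v + cdot n u w"
  "cdot n u (\<lambda>p. v p - w p) = cdot n u v - cdot n u w"
  "cdot n u (\<lambda>p. s * v p) = s * cdot n u v"
  "cdot n (\<lambda>p. v p + w p) u = cdot n v u + cdot n w u"
  "cdot n (\<lambda>p. v p - w p) u = cdot n v u - cdot n w u"
  "cdot n (\<lambda>p. s * v p) u = cnj s * cdot n v u"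
  "cdot n u (\<lambda>p. 0) = 0"
  "cdot n (\<lambda>p. 0) u = 0"
  by (simp_all add: cdot_def sum.distrib sum_subtractf sum_distrib_left algebra_simps)

lemma cdot_sum_right: "cdot n u (\<lambda>p. \<Sum>l\<in>I. f l p) = (\<Sum>l\<in>I. cdot n u (f l))"
  unfolding cdot_def by (simp add: sum_distrib_left sum.swap[of _ I])

lemma cdot_sum_left: "cdot n (\<lambda>p. \<Sum>l\<in>I. f l p) u = (\<Sum>l\<in>I. cdot n (f l) u)"
  unfolding cdot_def by (simp add: sum_distrib_right sum.swap[of _ I])

lemma nsq_eq_0_iff: "nsq n v = 0 \<longleftrightarrow> (\<forall>p<n. v p = 0)"
  unfolding nsq_def by (auto simp: sum_nonneg_eq_0_iff)

lemma cdot_eq_0: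
  assumes "nsq n u = 0"
  shows "cdot n u v = 0" "cdot n v u = 0"
  using assms by (auto simp: nsq_eq_0_iff cdot_def)

lemma nsq_add:
  "nsq n (\<lambda>p. u p + v p) = nsq n u + nsq n v + 2 * Re (cdot n u v)"
proof -
  have "complex_of_real (nsq n (\<lambda>p. u p + v p))
      = complex_of_real (nsq n u + nsq n v) + (cdot n u v + cnj (cdot n u v))"
    by (simp add: of_real_nsq cdot_cnj)
  also have "\<dots> = complex_of_real (nsq n u + nsq n v + 2 * Re (cdot n u v))"
    by (simp add: complex_add_cnj)
  finally show ?thesis
    using of_real_eq_iff by blast
qed

lemma nsq_scale: "nsq n (\<lambda>p. s * v p) = (cmod s)\<^sup>2 * nsq n v"
  by (simp add: nsq_def norm_mult power_mult_distrib sum_distrib_left)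

lemma nsq_add_orth:
  assumes "cdot n u v = 0"
  shows "nsq n (\<lambda>p. u p + v p) = nsq n u + nsq n v"
  using assms by (simp add: nsq_add)

lemma cdot_reject: "cdot n a (\<lambda>p. v p - cdot n a v / nsq n a * a p) = 0"
proof (cases "nsq n a = 0")
  case True
  then show ?thesis by (rule cdot_eq_0)
next
  case False
  then show ?thesis
    unfolding cdot_simps of_real_nsq[symmetric] by simp
qed

text \<open>Pythagoras for \<open>v\<close> split into its component along \<open>a\<close> and the
  remainder. Multiplying through by \<open>nsq n a\<close> makes the identity hold for
  \<open>a = 0\<close> as well, where both sides are 0.\<close>

lemma nsq_reject:
  "nsq n a * nsq n (\<lambda>p. v p - cdot n a v / nsq n a * a p) = nsq n a * nsq n v - (cmod (cdot n a v))\<^sup>2"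
proof (cases "nsq n a = 0")
  case True
  then show ?thesis by (simp add: cdot_eq_0)
next
  case False
  let ?s = "cdot n a v / nsq n a"
  have "nsq n v = nsq n (\<lambda>p. (v p - ?s * a p) + ?s * a p)"
    by simp
  also have "\<dots> = nsq n (\<lambda>p. v p - ?s * a p) + nsq n (\<lambda>p. ?s * a p)"
  proof (rule nsq_add_orth)
    have "cdot n a (\<lambda>p. v p - ?s * a p) = 0"
      by (rule cdot_reject)
    then have "cdot n (\<lambda>p. v p - ?s * a p) a = 0"
      by (metis cdot_cnj complex_cnj_zero)
    then show "cdot n (\<lambda>p. v p - ?s * a p) (\<lambda>p. ?s * a p) = 0"
      by (simp only: cdot_simps(3) mult_zero_right)
  qed
  finally have v: "nsq n v = nsq n (\<lambda>p. v p - ?s * a p) + (cmod ?s)\<^sup>2 * nsq n a"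
    unfolding nsq_scale .
  have s: "nsq n a * ((cmod ?s)\<^sup>2 * nsq n a) = (cmod (cdot n a v))\<^sup>2"
    using False by (simp add: norm_divide power_divide power2_eq_square)
  show ?thesis
    by (subst v) (simp only: distrib_left s add_diff_cancel_right')
qed

lemma cdot_Cauchy_Schwarz: "(cmod (cdot n u v))\<^sup>2 \<le> nsq n u * nsq n v"
proof -
  have "0 \<le> nsq n u * nsq n (\<lambda>p. v p - cdot n u v / nsq n u * u p)"
    by simp
  then show ?thesis
    unfolding nsq_reject by simp
qed

text \<open>Gram-Schmidt by induction on \<open>I\<close>, for vectors that may be linearly
  dependent. The induction hypothesis is used twice: \<open>x k\<close> and \<open>a\<close> are
  both made orthogonal to the earlier vectors, then the component along the new direction
  \<open>r\<close> is removed.\<close>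

lemma orth_projection_exists:
  fixes x :: "'l \<Rightarrow> nat \<Rightarrow> complex"
  assumes "finite I"
  shows "\<exists>z. \<forall>l\<in>I. cdot n (x l) (\<lambda>p. a p - (\<Sum>l\<in>I. x l p * z l)) = 0"
  using assms
proof (induction I arbitrary: a rule: finite_induct)
  case empty
  then show ?case by simp
next
  case (insert k I)
  obtain z where z: "\<forall>l\<in>I. cdot n (x l) (\<lambda>p. x k p - (\<Sum>l\<in>I. x l p * z l)) = 0"
    using insert.IH by blast
  obtain y where y: "\<forall>l\<in>I. cdot n (x l) (\<lambda>p. a p - (\<Sum>l\<in>I. x l p * y l)) = 0"
    using insert.IH by blast
  define r where "r = (\<lambda>p. x k p - (\<Sum>l\<in>I. x l p * z l))"
  define s where "s = (\<lambda>p. a p - (\<Sum>l\<in>I. x l p * y l))"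
  \<comment> \<open>If \<open>x k\<close> is already a combination of the other vectors, then
    \<open>r\<close> has norm 0 and division by zero gives \<open>t = 0\<close>.\<close>
  define t where "t = cdot n r s / nsq n r"
  \<comment> \<open>Coefficients of \<open>a\<close> in the original vectors, obtained by expanding
    \<open>r\<close> in \<open>s - t * r\<close>.\<close>
  define w where "w = (\<lambda>l. if l = k then t else y l - t * z l)"
  have xk: "x k = (\<lambda>p. r p + (\<Sum>l\<in>I. x l p * z l))"
    by (simp add: r_def)
  have rest: "(\<lambda>p. a p - (\<Sum>l\<in>insert k I. x l p * w l)) = (\<lambda>p. s p - t * r p)"
  proof
    fix p
    have "(\<Sum>l\<in>I. x l p * w l) = (\<Sum>l\<in>I. x l p * y l - t * (x l p * z l))"
      using insert.hyps by (intro sum.cong) (auto simp: w_def algebra_simps)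
    also have "\<dots> = (\<Sum>l\<in>I. x l p * y l) - t * (\<Sum>l\<in>I. x l p * z l)"
      by (simp add: sum_subtractf sum_distrib_left)
    finally show "a p - (\<Sum>l\<in>insert k I. x l p * w l) = s p - t * r p"
      using insert.hyps by (simp add: w_def r_def s_def algebra_simps)
  qed
  have I: "cdot n (x l) (\<lambda>p. s p - t * r p) = 0" if "l \<in> I" for l
    using that y z by (simp add: r_def s_def del: cdot_simps(2)) (simp add: r_def s_def)
  have "cdot n r (\<lambda>p. s p - t * r p) = 0"
    unfolding t_def by (rule cdot_reject)
  moreover have "cdot n (\<lambda>p. \<Sum>l\<in>I. x l p * z l) (\<lambda>p. s p - t * r p) = 0"
    unfolding cdot_sum_left
    by (rule sum.neutral) (simp add: I mult.commute[of "x _ _"] del: cdot_simps(2))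
  ultimately have "cdot n (x k) (\<lambda>p. s p - t * r p) = 0"
    by (subst xk) (simp del: cdot_simps(2))
  with I show ?case
    by (intro exI[of _ w]) (auto simp: rest simp del: cdot_simps(2))
qed

section \<open>The two draws of a pivot: row and column\<close>

text \<open>Since \<open>v\<close> is orthogonal to \<open>c\<close>, Pythagoras turns each summand
  with \<open>c i\<close> nonzero into \<open>|c i|^2 |v|^2 + |v i|^2 |c|^2\<close>, and both parts
  sum to \<open>|c|^2 |v|^2\<close>. Summands with \<open>c i = 0\<close> vanish on the left, hence
  only an inequality.\<close>

lemma row_pivot_sum_le:
  assumes "cdot n c v = 0"
  shows "(\<Sum>i<n. (cmod (c i))\<^sup>2 * nsq n (\<lambda>p. v p - c p * v i / c i)) \<le> 2 * nsq n c * nsq n v"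
proof -
  have "(\<Sum>i<n. (cmod (c i))\<^sup>2 * nsq n (\<lambda>p. v p - c p * v i / c i))
     \<le> (\<Sum>i<n. (cmod (c i))\<^sup>2 * nsq n v + (cmod (v i))\<^sup>2 * nsq n c)"
  proof (rule sum_mono)
    fix i
    let ?s = "- (v i / c i)"
    have "cdot n v c = 0"
      using assms by (metis cdot_cnj complex_cnj_zero)
    then have "nsq n (\<lambda>p. v p + ?s * c p) = nsq n v + (cmod ?s)\<^sup>2 * nsq n c"
      by (subst nsq_add_orth) (simp_all only: cdot_simps nsq_scale mult_zero_right)
    then have "nsq n (\<lambda>p. v p - c p * v i / c i) = nsq n v + (cmod (v i))\<^sup>2 / (cmod (c i))\<^sup>2 * nsq n c"
      by (simp add: norm_divide power_divide mult.commute)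
    then show "(cmod (c i))\<^sup>2 * nsq n (\<lambda>p. v p - c p * v i / c i)
        \<le> (cmod (c i))\<^sup>2 * nsq n v + (cmod (v i))\<^sup>2 * nsq n c"
      by (cases "c i = 0") (simp_all add: distrib_left)
  qed
  also have "\<dots> = 2 * nsq n c * nsq n v"
    by (simp add: sum.distrib flip: sum_distrib_right) (simp add: nsq_def)
  finally show ?thesis .
qed


text \<open>The bound for one fixed column \<open>j\<close>. The cross term is kept because it has a
  definite sign only after summation over \<open>j\<close> and \<open>q\<close>.\<close>

lemma column_pivot_approx:
  fixes x :: "'l \<Rightarrow> nat \<Rightarrow> complex" and y :: "'l \<Rightarrow> nat \<Rightarrow> complex" and E :: "nat \<Rightarrow> nat \<Rightarrow> complex"
  assumes I: "finite I" "card I \<le> Suc k"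
    and N: "\<And>q. N q = (\<lambda>p. \<Sum>l\<in>I. x l p * y l q)"
    and orth: "\<And>q r. cdot n (N q) (E r) = 0"
    and a: "a = (\<lambda>p. N j p + E j p)"
  shows "\<exists>J x' y'. finite (J :: 'l set) \<and> card J \<le> k \<and>
    (\<forall>q. let d = (\<lambda>p. N q p + E q p - (\<Sum>l\<in>J. x' l p * y' l q)) in
       nsq n a * nsq n (\<lambda>p. d p - cdot n a d / nsq n a * a p)
         \<le> nsq n a * nsq n (E q) + nsq n (E j) * nsq n (N q)
            - 2 * Re (cdot n (E j) (E q) * cdot n (N q) (N j)))"
proof -
  have orth': "cdot n (E r) (N q) = 0" for q r
    using orth[of q r] by (metis cdot_cnj complex_cnj_zero)
  have nsq_a: "nsq n a = nsq n (N j) + nsq n (E j)"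
    unfolding a by (rule nsq_add_orth) (rule orth)
  show ?thesis
  proof (cases "nsq n (N j) = 0")
    case True
    \<comment> \<open>With \<open>N j = 0\<close> the weight \<open>nsq n a\<close> is
      \<open>nsq n (E j)\<close> and the cross term vanishes. Approximating by zero then costs at
      most an extra \<open>nsq n (E j) * nsq n (N q)\<close>, which the bound allows.\<close>
    have "nsq n a * nsq n (\<lambda>p. N q p + E q p)
         - (cmod (cdot n a (\<lambda>p. N q p + E q p)))\<^sup>2
       \<le> nsq n a * nsq n (E q) + nsq n (E j) * nsq n (N q)
            - 2 * Re (cdot n (E j) (E q) * cdot n (N q) (N j))" for q
      unfolding nsq_a a using True
      by (simp add: nsq_add_orth orth orth' cdot_eq_0 algebra_simps)
    then show ?thesis
      by (intro exI[of _ "{}"])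
        (simp only: Let_def nsq_reject sum.empty diff_zero finite.emptyI card.empty le0 simp_thms)
  next
    case False
    define \<alpha> where "\<alpha> = nsq n (N j)"
    have \<alpha>: "\<alpha> > 0"
      using False nsq_nonneg[of n "N j"] by (simp add: \<alpha>_def order_less_le)
    \<comment> \<open>\<open>g q * N j\<close> is the projection of \<open>N q\<close> onto
      \<open>N j\<close>. The aim is to write \<open>N q - g q * N j\<close> with one term fewer,
      leaving the residual \<open>E q + g q * N j\<close>.\<close>
    define g where "g = (\<lambda>q. cdot n (N j) (N q) / \<alpha>)"
    define w where "w = (\<lambda>l. cdot n (N j) (x l))"
    have wN: "(\<Sum>l\<in>I. w l * y l q) = cdot n (N j) (N q)" for q
      by (subst (2) N) (simp add: cdot_sum_right w_def mult.commute[of _ "y _ _"])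
    have "(\<Sum>l\<in>I. w l * y l j) \<noteq> 0"
      using \<alpha> by (simp add: wN \<alpha>_def flip: of_real_nsq)
    then obtain l0 where l0: "l0 \<in> I" "w l0 \<noteq> 0"
      by (metis (no_types, lifting) mult_zero_left sum.neutral)
    define J where "J = I - {l0}"
    define x' where "x' = (\<lambda>l p. x l p - w l / w l0 * x l0 p)"
    define y' where "y' = (\<lambda>l q. y l q - g q * y l j)"
    \<comment> \<open>The coefficient vectors \<open>y'\<close> lie in the hyperplane orthogonal to \<open>w\<close>, which removes one term.\<close>
    have F: "(\<Sum>l\<in>J. x' l p * y' l q) = N q p - g q * N j p" for p q
    proof -
      have "(\<Sum>l\<in>I. w l * y' l q) = (\<Sum>l\<in>I. w l * y l q) - g q * (\<Sum>l\<in>I. w l * y l j)"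
        by (simp add: y'_def sum_subtractf sum_distrib_left algebra_simps)
      also have "\<dots> = 0"
        using \<alpha> by (simp add: wN g_def \<alpha>_def flip: of_real_nsq)
      finally have w0: "(\<Sum>l\<in>I. w l * y' l q) = 0" .
      have "(\<Sum>l\<in>J. x' l p * y' l q) = (\<Sum>l\<in>I. x' l p * y' l q)"
        unfolding J_def using I l0 by (intro sum.mono_neutral_left) (auto simp: x'_def)
      also have "\<dots> = (\<Sum>l\<in>I. x l p * y' l q) - x l0 p / w l0 * (\<Sum>l\<in>I. w l * y' l q)"
        by (simp add: x'_def sum_subtractf sum_distrib_left algebra_simps)
      also have "\<dots> = (\<Sum>l\<in>I. x l p * y' l q)"
        by (simp add: w0)
      also have "\<dots> = N q p - g q * N j p"
        by (simp add: N y'_def sum_subtractf sum_distrib_left algebra_simps)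
      finally show ?thesis .
    qed
    have "nsq n a * nsq n (\<lambda>p. E q p + g q * N j p)
         - (cmod (cdot n a (\<lambda>p. E q p + g q * N j p)))\<^sup>2
       \<le> nsq n a * nsq n (E q) + nsq n (E j) * nsq n (N q)
            - 2 * Re (cdot n (E j) (E q) * cdot n (N q) (N j))" for q
    proof -
      define h where "h = cdot n (N j) (N q)"
      define W where "W = cdot n (E j) (E q)"
      have hc: "cdot n (N q) (N j) = cnj h"
        by (simp add: h_def cdot_cnj)
      define s where "s = (cmod h)\<^sup>2 / \<alpha>"
      have s: "s \<le> nsq n (N q)" "\<alpha> * s = (cmod h)\<^sup>2"
        using cdot_Cauchy_Schwarz[of n "N j" "N q"] \<alpha>
        by (simp_all add: s_def h_def \<alpha>_def divide_le_eq mult.commute)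
      have "cdot n (E q) (\<lambda>p. g q * N j p) = 0"
        by (simp add: orth')
      then have "nsq n (\<lambda>p. E q p + g q * N j p) = nsq n (E q) + (cmod (g q))\<^sup>2 * \<alpha>"
        by (simp only: nsq_add_orth nsq_scale \<alpha>_def)
      then have 1: "nsq n (\<lambda>p. E q p + g q * N j p) = nsq n (E q) + s"
        using \<alpha> by (simp add: g_def s_def h_def norm_divide power_divide power2_eq_square)
      have 2: "cdot n a (\<lambda>p. E q p + g q * N j p) = W + h"
      proof -
        have "cdot n a (\<lambda>p. E q p + g q * N j p) = W + g q * \<alpha>"
          by (simp add: a orth orth' W_def \<alpha>_def of_real_nsq)
        also have "g q * \<alpha> = h"
          using \<alpha> by (simp add: g_def h_def)
        finally show ?thesis .
      qed
      have 3: "(cmod (W + h))\<^sup>2 = (cmod W)\<^sup>2 + (cmod h)\<^sup>2 + 2 * Re (W * cnj h)"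
        unfolding cmod_power2 by (simp add: power2_eq_square algebra_simps)
      \<comment> \<open>Expanding \<open>nsq_reject\<close> with 1, 2 and 3,
        \<open>\<alpha> * s\<close> cancels against \<open>(cmod h)^2\<close>. Of the contribution
        of \<open>s\<close> only \<open>nsq n (E j) * s\<close> remains, which Cauchy-Schwarz
        controls through \<open>s \<le> nsq n (N q)\<close>; the term in \<open>W\<close> alone has
        a favourable sign.\<close>
      have "nsq n (E j) * s \<le> (cmod W)\<^sup>2 + nsq n (E j) * nsq n (N q)"
        using s by (intro add_increasing mult_left_mono) simp_all
      then show ?thesis
        unfolding 1 2 3 hc nsq_a W_def[symmetric] \<alpha>_def[symmetric]
        using s(2) by (simp add: algebra_simps)
    qed
    moreover have "(\<lambda>p. N q p + E q p - (\<Sum>l\<in>J. x' l p * y' l q)) = (\<lambda>p. E q p + g q * N j p)" for q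
      by (simp add: F fun_eq_iff)
    moreover have "finite J" "card J \<le> k"
      using I l0 by (auto simp: J_def)
    ultimately show ?thesis
      by - (rule exI[of _ J], rule exI[of _ x'], rule exI[of _ y'],
          simp only: nsq_reject Let_def simp_thms)
  qed
qed

text \<open>The double sum is the squared Frobenius norm of the matrix \<open>M\<close>, which is
  \<open>E N^*\<close> when \<open>E j\<close> and \<open>N j\<close> are read as columns. The chain
  of equations expands the squares and reorders the fourfold sum.\<close>

lemma cross_sum_nonneg:
  "0 \<le> (\<Sum>j<m. \<Sum>q<m. Re (cdot n (E j) (E q) * cdot n (N q) (N j)))"
proof -
  define M where "M = (\<lambda>p r. \<Sum>q<m. E q p * cnj (N q r))"
  have "complex_of_real (\<Sum>p<n. \<Sum>r<n. (cmod (M p r))\<^sup>2) = (\<Sum>p<n. \<Sum>r<n. cnj (M p r) * M p r)"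
    by (simp add: complex_norm_square mult.commute del: of_real_power)
  also have "\<dots> = (\<Sum>p<n. \<Sum>r<n. \<Sum>j<m. \<Sum>q<m. (cnj (E j p) * E q p) * (cnj (N q r) * N j r))"
    by (simp add: M_def sum_product) (simp add: mult_ac)
  also have "\<dots> = (\<Sum>p<n. \<Sum>j<m. \<Sum>r<n. \<Sum>q<m. (cnj (E j p) * E q p) * (cnj (N q r) * N j r))"
    by (rule sum.cong[OF refl], rule sum.swap)
  also have "\<dots> = (\<Sum>j<m. \<Sum>p<n. \<Sum>r<n. \<Sum>q<m. (cnj (E j p) * E q p) * (cnj (N q r) * N j r))"
    by (rule sum.swap)
  also have "\<dots> = (\<Sum>j<m. \<Sum>p<n. \<Sum>q<m. \<Sum>r<n. (cnj (E j p) * E q p) * (cnj (N q r) * N j r))"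
    by (rule sum.cong[OF refl], rule sum.cong[OF refl], rule sum.swap)
  also have "\<dots> = (\<Sum>j<m. \<Sum>q<m. \<Sum>p<n. \<Sum>r<n. (cnj (E j p) * E q p) * (cnj (N q r) * N j r))"
    by (rule sum.cong[OF refl], rule sum.swap)
  also have "\<dots> = (\<Sum>j<m. \<Sum>q<m. cdot n (E j) (E q) * cdot n (N q) (N j))"
    by (simp add: cdot_def sum_product)
  finally have "(\<Sum>p<n. \<Sum>r<n. (cmod (M p r))\<^sup>2)
      = (\<Sum>j<m. \<Sum>q<m. Re (cdot n (E j) (E q) * cdot n (N q) (N j)))"
    by (metis (no_types, lifting) Re_complex_of_real Re_sum sum.cong)
  then show ?thesis
    by (metis (no_types, lifting) sum_nonneg zero_le_power2)
qed

text \<open>Averages the previous bound over the column draw, with unnormalised weights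
  \<open>nsq n (a j)\<close>. Since \<open>b\<close> does not mention the approximations, its sum
  can be bounded while \<open>J\<close>, \<open>x'\<close> and \<open>y'\<close> are chosen
  separately for each \<open>j\<close>.\<close>

lemma column_pivot_sum_le:
  fixes a :: "nat \<Rightarrow> nat \<Rightarrow> complex" and x y :: "'l \<Rightarrow> nat \<Rightarrow> complex"
  assumes I: "finite I" "card I \<le> Suc k"
  obtains b :: "nat \<Rightarrow> real"
  where "(\<Sum>j<m. b j) \<le> 2 * (\<Sum>q<m. nsq n (a q)) * (\<Sum>q<m. nsq n (\<lambda>p. a q p - (\<Sum>l\<in>I. x l p * y l q)))"
    and "\<And>j. \<exists>J x' y'. finite (J :: 'l set) \<and> card J \<le> k \<and>
      nsq n (a j) * (\<Sum>q<m. let d = (\<lambda>p. a q p - (\<Sum>l\<in>J. x' l p * y' l q)) in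
         nsq n (\<lambda>p. d p - cdot n (a j) d / nsq n (a j) * a j p)) \<le> b j"
proof -
  \<comment> \<open>The given coefficients \<open>y\<close> are replaced by least-squares ones. This
    supplies the orthogonality of \<open>N\<close> and \<open>E\<close> and can only decrease the
    error, as \<open>opt\<close> records.\<close>
  have "\<exists>z. \<forall>l\<in>I. cdot n (x l) (\<lambda>p. a q p - (\<Sum>l\<in>I. x l p * z l)) = 0" for q
    by (rule orth_projection_exists) (rule I)
  then obtain z where z: "\<And>q l. l \<in> I \<Longrightarrow> cdot n (x l) (\<lambda>p. a q p - (\<Sum>l\<in>I. x l p * z q l)) = 0"
    by metis
  define N where "N = (\<lambda>q p. \<Sum>l\<in>I. x l p * z q l)"
  define E where "E = (\<lambda>q p. a q p - N q p)"
  have xE: "cdot n (x l) (E q) = 0" if "l \<in> I" for l q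
    using z[OF that, of q] by (simp add: E_def N_def)
  have combE: "cdot n (\<lambda>p. \<Sum>l\<in>I. x l p * c l) (E r) = 0" for c r
    by (simp add: cdot_sum_left mult.commute[of "x _ _"] xE)
  then have orth: "cdot n (N q) (E r) = 0" for q r
    by (simp add: N_def)
  have aNE: "a q = (\<lambda>p. N q p + E q p)" for q
    by (simp add: E_def)
  have nsq_a: "nsq n (a q) = nsq n (N q) + nsq n (E q)" for q
    by (subst aNE) (rule nsq_add_orth, rule orth)
  define T where "T = (\<Sum>q<m. nsq n (a q))"
  define \<epsilon> where "\<epsilon> = (\<Sum>q<m. nsq n (E q))"
  define \<nu> where "\<nu> = (\<Sum>q<m. nsq n (N q))"
  have T: "T = \<nu> + \<epsilon>"
    by (simp add: T_def \<nu>_def \<epsilon>_def nsq_a sum.distrib)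
  have pos: "0 \<le> \<epsilon>" "0 \<le> \<nu>"
    by (simp_all add: \<epsilon>_def \<nu>_def sum_nonneg)
  have "nsq n (E q) \<le> nsq n (\<lambda>p. a q p - (\<Sum>l\<in>I. x l p * y l q))" for q
  proof -
    let ?c = "\<lambda>p. \<Sum>l\<in>I. x l p * (z q l - y l q)"
    have "(\<lambda>p. a q p - (\<Sum>l\<in>I. x l p * y l q)) = (\<lambda>p. ?c p + E q p)"
      by (simp add: fun_eq_iff E_def N_def right_diff_distrib sum_subtractf)
    then show ?thesis
      by (simp add: nsq_add_orth combE)
  qed
  then have opt: "\<epsilon> \<le> (\<Sum>q<m. nsq n (\<lambda>p. a q p - (\<Sum>l\<in>I. x l p * y l q)))"
    by (simp add: \<epsilon>_def sum_mono)
  define b where "b = (\<lambda>j. \<Sum>q<m. nsq n (a j) * nsq n (E q) + nsq n (E j) * nsq n (N q)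
            - 2 * Re (cdot n (E j) (E q) * cdot n (N q) (N j)))"
  have "(\<Sum>j<m. b j) = T * \<epsilon> + \<epsilon> * \<nu> - 2 * (\<Sum>j<m. \<Sum>q<m. Re (cdot n (E j) (E q) * cdot n (N q) (N j)))"
    by (simp only: b_def sum.distrib sum_subtractf T_def \<epsilon>_def \<nu>_def sum_product)
       (simp only: sum_distrib_left)
  also have "\<dots> \<le> T * \<epsilon> + \<epsilon> * \<nu>"
    using cross_sum_nonneg[of n E N m] by simp
  \<comment> \<open>This is the factor 2 of the column draw: \<open>\<nu> \<le> T\<close> because
    \<open>T = \<nu> + \<epsilon>\<close>.\<close>
  also have "\<dots> \<le> 2 * T * \<epsilon>"
    using pos by (simp add: T algebra_simps)
  also have "\<dots> \<le> 2 * T * (\<Sum>q<m. nsq n (\<lambda>p. a q p - (\<Sum>l\<in>I. x l p * y l q)))"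
    using opt pos by (intro mult_left_mono) (simp_all add: T)
  finally have sum_b: "(\<Sum>j<m. b j) \<le> 2 * T * (\<Sum>q<m. nsq n (\<lambda>p. a q p - (\<Sum>l\<in>I. x l p * y l q)))" .
  have "\<exists>J x' y'. finite (J :: 'l set) \<and> card J \<le> k \<and>
      nsq n (a j) * (\<Sum>q<m. let d = (\<lambda>p. a q p - (\<Sum>l\<in>J. x' l p * y' l q)) in
         nsq n (\<lambda>p. d p - cdot n (a j) d / nsq n (a j) * a j p)) \<le> b j" for j
  proof -
    have "\<exists>J x' y'. finite (J :: 'l set) \<and> card J \<le> k \<and>
      (\<forall>q. let d = (\<lambda>p. N q p + E q p - (\<Sum>l\<in>J. x' l p * y' l q)) in
       nsq n (a j) * nsq n (\<lambda>p. d p - cdot n (a j) d / nsq n (a j) * a j p)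
         \<le> nsq n (a j) * nsq n (E q) + nsq n (E j) * nsq n (N q)
            - 2 * Re (cdot n (E j) (E q) * cdot n (N q) (N j)))"
      by (rule column_pivot_approx[where y = "\<lambda>l q. z q l"]) (use I orth in \<open>simp_all add: N_def E_def\<close>)
    then obtain J x' y' where J: "finite (J :: 'l set)" "card J \<le> k" and
      le: "\<And>q. let d = (\<lambda>p. N q p + E q p - (\<Sum>l\<in>J. x' l p * y' l q)) in
       nsq n (a j) * nsq n (\<lambda>p. d p - cdot n (a j) d / nsq n (a j) * a j p)
         \<le> nsq n (a j) * nsq n (E q) + nsq n (E j) * nsq n (N q)
            - 2 * Re (cdot n (E j) (E q) * cdot n (N q) (N j))"
      by blast
    have "nsq n (a j) * (\<Sum>q<m. let d = (\<lambda>p. a q p - (\<Sum>l\<in>J. x' l p * y' l q)) in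
         nsq n (\<lambda>p. d p - cdot n (a j) d / nsq n (a j) * a j p)) \<le> b j"
      unfolding b_def sum_distrib_left
    proof (rule sum_mono)
      fix q
      show "nsq n (a j) * (let d = (\<lambda>p. a q p - (\<Sum>l\<in>J. x' l p * y' l q)) in
         nsq n (\<lambda>p. d p - cdot n (a j) d / nsq n (a j) * a j p))
         \<le> nsq n (a j) * nsq n (E q) + nsq n (E j) * nsq n (N q)
            - 2 * Re (cdot n (E j) (E q) * cdot n (N q) (N j))"
        using le[of q] by (simp only: Let_def aNE[symmetric, of q, THEN fun_cong])
    qed
    with J show ?thesis by blast
  qed
  with sum_b that show thesis
    unfolding T_def by blast
qed

section \<open>Recursion for the expected squared residual and its bound\<close>

text \<open>A zero residual has value 0 because \<open>0 / 0 = 0\<close>.\<close>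

fun rplu_value :: "nat \<Rightarrow> complex mat \<Rightarrow> real" where
  "rplu_value 0 R = (frobenius_norm R)\<^sup>2"
| "rplu_value (Suc t) R = (\<Sum>j<dim_col R. \<Sum>i<dim_row R.
     (cmod (R $$ (i, j)))\<^sup>2 / (frobenius_norm R)\<^sup>2 * rplu_value t (R - cross_term R i j))"

lemma frobenius_norm_sq_columns:
  assumes "R \<in> carrier_mat n m"
  shows "(frobenius_norm R)\<^sup>2 = (\<Sum>q<m. nsq n (\<lambda>p. R $$ (p, q)))"
  using assms unfolding frobenius_norm_sq nsq_def by (simp add: sum.swap[of _ "{..<m}"])

lemma nsq_cong: "(\<And>p. p < n \<Longrightarrow> u p = v p) \<Longrightarrow> nsq n u = nsq n v"
  unfolding nsq_def by simp

text \<open>Rank at most \<open>k\<close> is encoded as a sum of at most \<open>k\<close> products,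
  so lowering the rank means removing an index. The factors are arbitrary because the induction
  applies the bound to the approximations constructed for the Schur complements.\<close>

lemma rplu_value_le:
  fixes x y :: "'l \<Rightarrow> nat \<Rightarrow> complex"
  assumes "R \<in> carrier_mat n m" "finite I" "card I \<le> k"
  shows "rplu_value k R \<le> 4 ^ k * (\<Sum>q<m. nsq n (\<lambda>p. R $$ (p, q) - (\<Sum>l\<in>I. x l p * y l q)))"
  using assms
proof (induction k arbitrary: R I x y)
  case 0
  then show ?case by (simp add: frobenius_norm_sq_columns)
next
  case (Suc k)
  define T where "T = (frobenius_norm R)\<^sup>2"
  define a where "a = (\<lambda>q p. R $$ (p, q))"
  let ?err = "\<Sum>q<m. nsq n (\<lambda>p. a q p - (\<Sum>l\<in>I. x l p * y l q))"
  have dims: "dim_row R = n" "dim_col R = m"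
    using Suc.prems by auto
  have T: "T = (\<Sum>q<m. nsq n (a q))"
    using Suc.prems by (simp add: T_def a_def frobenius_norm_sq_columns)
  obtain b where b: "(\<Sum>j<m. b j) \<le> 2 * T * ?err"
    and step: "\<And>j. \<exists>J x' y'. finite (J :: 'l set) \<and> card J \<le> k \<and>
      nsq n (a j) * (\<Sum>q<m. let d = (\<lambda>p. a q p - (\<Sum>l\<in>J. x' l p * y' l q)) in
         nsq n (\<lambda>p. d p - cdot n (a j) d / nsq n (a j) * a j p)) \<le> b j"
    by (rule column_pivot_sum_le[OF Suc.prems(2,3), where m = m and n = n and a = a and x = x and y = y])
      (rule that, simp_all only: T)
  have col: "(\<Sum>i<n. (cmod (a j i))\<^sup>2 * rplu_value k (R - cross_term R i j)) \<le> 4 ^ k * (2 * b j)"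
    if j: "j < m" for j
  proof -
    obtain J x' y' where J: "finite (J :: 'l set)" "card J \<le> k" and
      le: "nsq n (a j) * (\<Sum>q<m. let d = (\<lambda>p. a q p - (\<Sum>l\<in>J. x' l p * y' l q)) in
         nsq n (\<lambda>p. d p - cdot n (a j) d / nsq n (a j) * a j p)) \<le> b j"
      using step[of j] by blast
    define d where "d = (\<lambda>q p. a q p - (\<Sum>l\<in>J. x' l p * y' l q))"
    define v where "v = (\<lambda>q p. d q p - cdot n (a j) (d q) / nsq n (a j) * a j p)"
    have le': "nsq n (a j) * (\<Sum>q<m. nsq n (v q)) \<le> b j"
      using le by (simp add: d_def v_def Let_def)
    have v: "cdot n (a j) (v q) = 0" for q
      unfolding v_def by (rule cdot_reject)
    have "(\<Sum>i<n. (cmod (a j i))\<^sup>2 * rplu_value k (R - cross_term R i j))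
        \<le> (\<Sum>i<n. \<Sum>q<m. 4 ^ k * ((cmod (a j i))\<^sup>2 * nsq n (\<lambda>p. v q p - a j p * v q i / a j i)))"
    proof (rule sum_mono)
      fix i assume "i \<in> {..<n}"
      then have i: "i < n" by simp
      show "(cmod (a j i))\<^sup>2 * rplu_value k (R - cross_term R i j)
        \<le> (\<Sum>q<m. 4 ^ k * ((cmod (a j i))\<^sup>2 * nsq n (\<lambda>p. v q p - a j p * v q i / a j i)))"
      proof (cases "a j i = 0")
        case True
        then show ?thesis by simp
      next
        case False
        let ?R = "R - cross_term R i j"
        \<comment> \<open>Elimination with row \<open>i\<close> is linear on columns, so applying it
          to each \<open>x' l\<close> gives an approximation of the Schur complement with the same
          index set \<open>J\<close>.\<close>
        let ?x = "\<lambda>l p. x' l p - a j p * x' l i / a j i"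
        have "?R \<in> carrier_mat n m"
          using Suc.prems by (auto simp: cross_term_def)
        then have "rplu_value k ?R
            \<le> 4 ^ k * (\<Sum>q<m. nsq n (\<lambda>p. ?R $$ (p, q) - (\<Sum>l\<in>J. ?x l p * y' l q)))"
          using J by (rule Suc.IH)
        also have "(\<Sum>q<m. nsq n (\<lambda>p. ?R $$ (p, q) - (\<Sum>l\<in>J. ?x l p * y' l q)))
            = (\<Sum>q<m. nsq n (\<lambda>p. v q p - a j p * v q i / a j i))"
        proof (intro sum.cong refl nsq_cong)
          fix q p assume "q \<in> {..<m}" and p: "p < n"
          then have q: "q < m" by simp
          have R: "?R $$ (p, q) = a q p - a j p * a q i / a j i"
            using p q dims by (simp add: cross_term_def a_def)
          have S: "(\<Sum>l\<in>J. ?x l p * y' l q)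
             = (\<Sum>l\<in>J. x' l p * y' l q) - a j p / a j i * (\<Sum>l\<in>J. x' l i * y' l q)"
            by (simp add: left_diff_distrib sum_subtractf sum_distrib_left mult.assoc)
          have "?R $$ (p, q) - (\<Sum>l\<in>J. ?x l p * y' l q) = d q p - a j p * d q i / a j i"
            unfolding R S d_def by (simp add: right_diff_distrib diff_divide_distrib)
          \<comment> \<open>Elimination annihilates multiples of \<open>a j\<close>, so
            \<open>d q\<close> may be replaced by its part \<open>v q\<close> orthogonal to
            \<open>a j\<close>, as \<open>row_pivot_sum_le\<close> requires.\<close>
          also have "\<dots> = v q p - a j p * v q i / a j i"
            unfolding v_def using False by (simp add: right_diff_distrib diff_divide_distrib)
          finally show "?R $$ (p, q) - (\<Sum>l\<in>J. ?x l p * y' l q) = v q p - a j p * v q i / a j i" .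
        qed
        finally have "(cmod (a j i))\<^sup>2 * rplu_value k ?R
           \<le> (cmod (a j i))\<^sup>2 * (4 ^ k * (\<Sum>q<m. nsq n (\<lambda>p. v q p - a j p * v q i / a j i)))"
          by (rule mult_left_mono) simp
        then show ?thesis
          by (simp add: sum_distrib_left mult.left_commute)
      qed
    qed
    also have "\<dots> = 4 ^ k * (\<Sum>q<m. \<Sum>i<n. (cmod (a j i))\<^sup>2 * nsq n (\<lambda>p. v q p - a j p * v q i / a j i))"
      by (subst sum.swap) (simp add: sum_distrib_left)
    also have "\<dots> \<le> 4 ^ k * (\<Sum>q<m. 2 * nsq n (a j) * nsq n (v q))"
      by (intro mult_left_mono sum_mono row_pivot_sum_le v) simp
    also have "\<dots> = 4 ^ k * (2 * (nsq n (a j) * (\<Sum>q<m. nsq n (v q))))"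
      by (simp add: sum_distrib_left mult.assoc)
    also have "\<dots> \<le> 4 ^ k * (2 * b j)"
      using le' by simp
    finally show ?thesis .
  qed
  have "rplu_value (Suc k) R
      = (\<Sum>j<m. \<Sum>i<n. (cmod (a j i))\<^sup>2 * rplu_value k (R - cross_term R i j)) / T"
    by (simp add: dims T_def a_def sum_divide_distrib)
  also have "\<dots> \<le> (\<Sum>j<m. 4 ^ k * (2 * b j)) / T"
    using col by (intro divide_right_mono sum_mono) (auto simp: T_def)
  also have "\<dots> = 4 ^ k * 2 * (\<Sum>j<m. b j) / T"
    by (simp add: sum_distrib_left mult.assoc)
  also have "\<dots> \<le> 4 ^ k * 2 * (2 * T * ?err) / T"
    using b by (intro divide_right_mono mult_left_mono) (auto simp: T_def)
  \<comment> \<open>The two factors 2 combine to 4. If \<open>T = 0\<close>, the left side is 0 by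
    division by zero.\<close>
  also have "\<dots> \<le> 4 ^ Suc k * ?err"
    by (cases "T = 0") (simp_all add: sum_nonneg)
  finally show ?case
    by (simp add: a_def)
qed

section \<open>The recursion computes the expectation over the pivots\<close>

lemma rplu_value_zero: "R = 0\<^sub>m (dim_row R) (dim_col R) \<Longrightarrow> rplu_value t R = 0"
  using frobenius_norm_eq_0_iff[of R] by (cases t) simp_all

lemma expectation_bind_pmf_finite:
  fixes h :: "'b \<Rightarrow> real"
  assumes "finite (set_pmf p)" "\<And>x. finite (set_pmf (f x))"
  shows "measure_pmf.expectation (bind_pmf p f) h
       = measure_pmf.expectation p (\<lambda>x. measure_pmf.expectation (f x) h)"
  using assms
  by (subst pmf_expectation_bind[where A = "set_pmf p"])
     (simp_all add: integral_measure_pmf[where A = "set_pmf p"])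

lemma finite_set_pmf_rplu_step: "finite (set_pmf (rplu_step s))"
proof (cases s)
  case (Pair R H)
  have "finite {(i, j). i < dim_row R \<and> j < dim_col R \<and> R $$ (i, j) \<noteq> 0}"
    by (rule finite_subset[of _ "{..<dim_row R} \<times> {..<dim_col R}"]) auto
  then show ?thesis
    by (simp add: Pair rplu_step_def set_pmf_pivot_pmf)
qed

lemma expectation_rplu_step:
  "measure_pmf.expectation (rplu_step s) (\<lambda>s'. rplu_value t (fst s')) = rplu_value (Suc t) (fst s)"
proof (cases s)
  case (Pair R H)
  show ?thesis
  proof (cases "R = 0\<^sub>m (dim_row R) (dim_col R)")
    case True
    then have "rplu_value t R = 0" "rplu_value (Suc t) R = 0"
      by (rule rplu_value_zero)+
    with True show ?thesis
      by (simp add: Pair rplu_step_def del: rplu_value.simps)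
  next
    case False
    let ?V = "\<lambda>(i, j). rplu_value t (R - cross_term R i j)"
    have "measure_pmf.expectation (rplu_step s) (\<lambda>s'. rplu_value t (fst s'))
        = measure_pmf.expectation (pivot_pmf R) ?V"
      using False by (simp add: Pair rplu_step_def case_prod_unfold)
    also have "\<dots> = (\<Sum>x\<in>{..<dim_row R} \<times> {..<dim_col R}. pmf (pivot_pmf R) x *\<^sub>R ?V x)"
      by (rule integral_measure_pmf) (use False in \<open>auto simp: set_pmf_pivot_pmf\<close>)
    also have "\<dots> = (\<Sum>i<dim_row R. \<Sum>j<dim_col R. pmf (pivot_pmf R) (i, j) *\<^sub>R ?V (i, j))"
      by (simp add: sum.cartesian_product case_prod_beta)
    also have "\<dots> = rplu_value (Suc t) R"
      by (subst sum.swap) (simp add: pmf_pivot_pmf[OF False])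
    finally show ?thesis
      by (simp add: Pair)
  qed
qed

text \<open>\<open>rplu\<close> appends its steps at the end, whereas \<open>rplu_value\<close>
  unfolds from the first step. Generalising over \<open>t\<close> reconciles the two: integrating
  out the last random step raises \<open>t\<close> by one.\<close>

lemma expectation_rplu:
  "measure_pmf.expectation (rplu A k) (\<lambda>s. rplu_value t (fst s)) = rplu_value (t + k) A"
proof (induction k arbitrary: t)
  case 0
  then show ?case by simp
next
  case (Suc k)
  then show ?case
    using Suc.IH[of "Suc t"]
    by (simp add: expectation_bind_pmf_finite finite_set_pmf_rplu finite_set_pmf_rplu_step
        expectation_rplu_step del: rplu_value.simps)
qed

section \<open>The truncated SVD as a sum of at most k rank-one terms, and the final bound\<close>

text \<open>In the proper truncation the inner dimension of the product of leading blocks is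
  \<open>k\<close>, so the terms are columns of \<open>X\<close> times rows of \<open>Y\<close>.
  When \<open>k \<ge> min n m\<close>, the matrix \<open>A\<close> itself is split into its rows or
  columns, whichever number at most \<open>k\<close>, with unit vectors as the other
  factors.\<close>

lemma truncated_svd_factors:
  assumes A: "A \<in> carrier_mat n m" and svd: "is_truncated_svd k A B"
  obtains I :: "nat set" and x y :: "nat \<Rightarrow> nat \<Rightarrow> complex"
  where "B \<in> carrier_mat n m" "finite I" "card I \<le> k"
    "\<And>p q. p < n \<Longrightarrow> q < m \<Longrightarrow> B $$ (p, q) = (\<Sum>l\<in>I. x l p * y l q)"
proof (cases "k \<ge> min n m")
  case True
  with A svd have B: "B = A"
    by (auto simp: is_truncated_svd_def)
  show thesis
  proof (cases "n \<le> k")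
    case True
    show thesis
      by (rule that[where I = "{..<n}" and x = "\<lambda>l p. if p = l then 1 else 0" and y = "\<lambda>l q. A $$ (l, q)"])
         (use True A B in \<open>simp_all add: if_distrib[of "\<lambda>u. u * _"] cong: if_cong\<close>)
  next
    case False
    show thesis
      by (rule that[where I = "{..<m}" and x = "\<lambda>l p. A $$ (p, l)" and y = "\<lambda>l q. if q = l then 1 else 0"])
         (use False \<open>min n m \<le> k\<close> A B in \<open>simp_all add: if_distrib[of "\<lambda>u. _ * u"] cong: if_cong\<close>)
  qed
next
  case False
  from svd obtain U S V where
    "B = (if k \<ge> min (dim_row A) (dim_col A) then A
             else leading_block (dim_row A) k U * leading_block k k S *
                  mat_adjoint (leading_block (dim_col A) k V))"
    unfolding is_truncated_svd_def by blast
  with False A have B: "B = leading_block n k U * leading_block k k S * mat_adjoint (leading_block m k V)"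
    by auto
  define X where "X = leading_block n k U * leading_block k k S"
  define Y where "Y = mat_adjoint (leading_block m k V)"
  have XY: "X \<in> carrier_mat n k" "Y \<in> carrier_mat k m"
    by (auto simp: X_def Y_def leading_block_def mat_adjoint_def)
  show thesis
  proof (rule that[where I = "{..<k}" and x = "\<lambda>l p. X $$ (p, l)" and y = "\<lambda>l q. Y $$ (l, q)"])
    fix p q assume "p < n" "q < m"
    with XY show "B $$ (p, q) = (\<Sum>l<k. X $$ (p, l) * Y $$ (l, q))"
      by (simp add: B scalar_prod_def lessThan_atLeast0 flip: X_def Y_def)
  qed (use XY in \<open>auto simp: B simp flip: X_def Y_def\<close>)
qed

theorem theorem3:
  fixes A B :: "complex mat" and n m k :: nat
  assumes "A \<in> carrier_mat n m"
    and "k \<ge> 1"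
    and "is_truncated_svd k A B"
  shows "measure_pmf.expectation (rplu_approx A k) (\<lambda>H. (frobenius_norm (A - H))\<^sup>2)
           \<le> 4 ^ k * (frobenius_norm (A - B))\<^sup>2"
proof -
  have "measure_pmf.expectation (rplu_approx A k) (\<lambda>H. (frobenius_norm (A - H))\<^sup>2)
      = measure_pmf.expectation (rplu A k) (\<lambda>s. (frobenius_norm (A - snd s))\<^sup>2)"
    by (simp add: rplu_approx_def)
  \<comment> \<open>On the support of \<open>rplu\<close>, the difference \<open>A - snd s\<close>
    is the residual \<open>fst s\<close>, so the two integrands agree almost everywhere.\<close>
  also have "\<dots> = measure_pmf.expectation (rplu A k) (\<lambda>s. rplu_value 0 (fst s))"
    using rplu_residual[OF assms(1)]
    by (intro integral_cong_AE) (auto simp: AE_measure_pmf_iff)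
  also have "\<dots> = rplu_value k A"
    by (simp only: expectation_rplu add_0)
  finally have E: "measure_pmf.expectation (rplu_approx A k) (\<lambda>H. (frobenius_norm (A - H))\<^sup>2)
      = rplu_value k A" .
  obtain I :: "nat set" and x y :: "nat \<Rightarrow> nat \<Rightarrow> complex" where
    B: "B \<in> carrier_mat n m" and I: "finite I" "card I \<le> k"
    and xy: "\<And>p q. p < n \<Longrightarrow> q < m \<Longrightarrow> B $$ (p, q) = (\<Sum>l\<in>I. x l p * y l q)"
    using truncated_svd_factors[OF assms(1,3)] by blast
  have "rplu_value k A \<le> 4 ^ k * (\<Sum>q<m. nsq n (\<lambda>p. A $$ (p, q) - (\<Sum>l\<in>I. x l p * y l q)))"
    using assms(1) I by (rule rplu_value_le)
  also have "(\<Sum>q<m. nsq n (\<lambda>p. A $$ (p, q) - (\<Sum>l\<in>I. x l p * y l q))) = (frobenius_norm (A - B))\<^sup>2"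
    using assms(1) B by (subst frobenius_norm_sq_columns[of _ n m]) (auto intro!: sum.cong nsq_cong simp: xy)
  finally show ?thesis
    unfolding E .
qed

end
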